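(* Let $p$ be an odd prime and let $\mathbb{P}=\mathbb{C}_p[x]$. For every polynomial $q(x)\in\mathbb{P}$, $$\int_{\mathbb{Z}_p}q(x+y)\,d\mu_{-1}(y)=\left(\int_{\mathbb{Z}_p}e^{yt}\,d\mu_{-1}(y)\right)q(x)=\frac{2}{e^t+1}\,q(x),$$ where in the second and third expressions the formal power series in $t$ acts on $q(x)$ as a differential operator, $t$ acting as $\frac{d}{dx}$.
   Context: $p$ is a fixed odd prime; $\mathbb{Z}_p$ is the ring of $p$-adic integers and $\mathbb{C}_p$ is the completion of the algebraic closure of $\mathbb{Q}_p$. Fermionic $p$-adic integral: for a continuous function $f:\mathbb{Z}_p\to\mathbb{C}_p$, $$\int_{\mathbb{Z}_p}f(x)\,d\mu_{-1}(x)=\lim_{N\to\infty}\sum_{x=0}^{p^N-1}f(x)(-1)^x .$$ In $\int_{\mathbb{Z}_p}q(x+y)\,d\mu_{-1}(y)$ the integration is in the variable $y\in\mathbb{Z}_p$, and the result is regarded as a function (polynomial) of $x$, $x\in\mathbb{C}_p$. $\mathcal{F}$ is the algebra of formal power series $f(t)=\sum_{k\ge0}\frac{a_k}{k!}t^k$ with $a_k\in\mathbb{C}_p$. It acts on $\mathbb{P}=\mathbb{C}_p[x]$ by $t^kq(x)=q^{(k)}(x)=\frac{d^kq(x)}{dx^k}$, i.e. $f(t)q(x)=\sum_{k\ge0}\frac{a_k}{k!}q^{(k)}(x)$ (a finite sum). The symbol $\int_{\mathbb{Z}_p}e^{yt}\,d\mu_{-1}(y)$ denotes the formal power series $\sum_{k\ge0}\left(\int_{\mathbb{Z}_p}y^k\,d\mu_{-1}(y)\right)\frac{t^k}{k!}\in\mathcal{F}$,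 and $\frac{2}{e^t+1}\in\mathcal{F}$ is the quotient in the ring of formal power series, with $e^t=\sum_{k\ge0}t^k/k!$. *)

theory Defs
  imports
    "HOL-Analysis.Analysis"
    "HOL-Computational_Algebra.Computational_Algebra"
begin

definition rat_padic_abs :: "nat \<Rightarrow> rat \<Rightarrow> real" where
  "rat_padic_abs p r =
     (if r = 0 then 0
      else real p powi (int (multiplicity (int p) (snd (quotient_of r)))
                        - int (multiplicity (int p) (fst (quotient_of r)))))"

text \<open>The ambient type plays the role of the complete field \<open>\<complex>\<^sub>p\<close>. Since it is complete,
  the topological closure of the rationals in it is the completion \<open>\<rat>\<^sub>p\<close> of the rationals.\<close>

definition padic_numbers :: "'a::{field_char_0, metric_space} set" where
  "padic_numbers = closure \<rat>"

definition padic_integers :: "('a::{field_char_0, metric_space} \<Rightarrow> real) \<Rightarrow> 'a set" where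
  "padic_integers cabs = {x \<in> padic_numbers. cabs x \<le> 1}"

definition padic_algebraic :: "'a::{field_char_0, metric_space} set" where
  "padic_algebraic =
     {x. \<exists>f :: 'a poly. f \<noteq> 0 \<and> (\<forall>i. coeff f i \<in> padic_numbers) \<and> poly f x = 0}"

text \<open>The field \<open>\<complex>\<^sub>p\<close>, determined up to isometric isomorphism: a complete field with a
  non-archimedean absolute value extending the \<open>p\<close>-adic one, in which the elements algebraic
  over \<open>\<rat>\<^sub>p\<close> form an algebraic closure of \<open>\<rat>\<^sub>p\<close> and are dense. Completeness is the sort
  constraint; positivity and definiteness of \<open>cabs\<close> follow from \<open>dist_cabs\<close>.\<close>

locale padic_complex_field =
  fixes p :: nat
    and cabs :: "'a::{field_char_0, complete_space} \<Rightarrow> real"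
  assumes prime_p: "prime p"
    and dist_cabs: "\<And>x y. dist x y = cabs (x - y)"
    and cabs_mult: "\<And>x y. cabs (x * y) = cabs x * cabs y"
    and cabs_add_le: "\<And>x y. cabs (x + y) \<le> max (cabs x) (cabs y)"
    and cabs_of_rat: "\<And>r. cabs (of_rat r) = rat_padic_abs p r"
    and padic_algebraic_closed:
      "\<And>f :: 'a poly. \<lbrakk>\<forall>i. coeff f i \<in> padic_algebraic; degree f > 0\<rbrakk>
         \<Longrightarrow> \<exists>x \<in> padic_algebraic. poly f x = 0"
    and padic_algebraic_dense: "closure (padic_algebraic :: 'a set) = UNIV"

text \<open>Functions on the \<open>p\<close>-adic integers are represented by functions on the whole field;
  the integral only looks at the values at natural numbers.\<close>

definition fermionic_sum :: "nat \<Rightarrow> ('a::field_char_0 \<Rightarrow> 'a) \<Rightarrow> nat \<Rightarrow> 'a" where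
  "fermionic_sum p f N = (\<Sum>x<p ^ N. f (of_nat x) * (- 1) ^ x)"

definition fermionic_integral ::
    "nat \<Rightarrow> ('a::{field_char_0, metric_space} \<Rightarrow> 'a) \<Rightarrow> 'a" where
  "fermionic_integral p f = lim (fermionic_sum p f)"

text \<open>The limit \<^const>\<open>lim\<close> is a junk value unless the sequence converges.\<close>

definition fermionic_integrable ::
    "nat \<Rightarrow> ('a::{field_char_0, metric_space} \<Rightarrow> real) \<Rightarrow> ('a \<Rightarrow> 'a) \<Rightarrow> bool" where
  "fermionic_integrable p cabs f \<longleftrightarrow>
     continuous_on (padic_integers cabs) f \<and> convergent (fermionic_sum p f)"

text \<open>The action in which \<open>t\<close> is differentiation. If \<open>f = (\<Sum>k. a\<^sub>k / k! t\<^sup>k)\<close> then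
  \<open>fps_nth f k\<close> is \<open>a\<^sub>k / k!\<close>; derivatives of order above the degree vanish, so
  the sum may stop there.\<close>

definition fps_diff_op :: "'a::field_char_0 fps \<Rightarrow> 'a poly \<Rightarrow> 'a poly" where
  "fps_diff_op f q = (\<Sum>k\<le>degree q. smult (fps_nth f k) ((pderiv ^^ k) q))"

text \<open>The series denoted by the integral of \<open>e\<^sup>y\<^sup>t\<close> in the variable \<open>y\<close>.\<close>

definition fermionic_exp_series :: "nat \<Rightarrow> 'a::{field_char_0, metric_space} fps" where
  "fermionic_exp_series p = Abs_fps (\<lambda>k. fermionic_integral p (\<lambda>y. y ^ k) / fact k)"

end

theory Submission
  imports Defs
begin

text \<open>Let \<open>E = 2 / (e\<^sup>t + 1)\<close> and \<open>r = E q\<close>. Since \<open>e\<^sup>t\<close> acts as the shift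
  \<open>q(x) \<mapsto> q(x + 1)\<close>, the identity \<open>(e\<^sup>t + 1) E = 2\<close> says \<open>r(x + 1) + r(x) = 2 q(x)\<close>. Hence the
  alternating sum of \<open>q(x + y)\<close> over \<open>y < p\<^sup>N\<close> telescopes to \<open>(r(x) + r(x + p\<^sup>N)) / 2\<close>, which tends
  to \<open>r(x)\<close> because \<open>p\<^sup>N\<close> tends to \<open>0\<close>. The moments of \<open>\<mu>\<^sub>-\<^sub>1\<close>, read off at \<open>q = x\<^sup>k\<close> and
  \<open>x = 0\<close>, are therefore \<open>k!\<close> times the coefficients of \<open>E\<close>.\<close>

section \<open>Formal power series acting as differential operators\<close>

lemma higher_pderiv_eq_0:
  fixes q :: "'a::field_char_0 poly"
  assumes "degree q < k"
  shows "(pderiv ^^ k) q = 0"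
  using assms by (intro poly_eqI) (simp add: coeff_higher_pderiv coeff_eq_0)

text \<open>Frees the cut-off from the degree, so that sums attached to polynomials of different
  degrees can be compared over one range.\<close>

lemma fps_diff_op_eq_sum:
  assumes "degree q \<le> n"
  shows "fps_diff_op f q = (\<Sum>k\<le>n. smult (fps_nth f k) ((pderiv ^^ k) q))"
  unfolding fps_diff_op_def
  by (rule sum.mono_neutral_left) (use assms in \<open>auto simp: higher_pderiv_eq_0\<close>)

lemma fps_diff_op_add: "fps_diff_op (f + g) q = fps_diff_op f q + fps_diff_op g q"
  by (simp add: fps_diff_op_def smult_add_left sum.distrib)

lemma fps_diff_op_const: "fps_diff_op (fps_const c) q = smult c q"
proof -
  have "fps_diff_op (fps_const c) q = (\<Sum>k\<in>{0}. smult (fps_nth (fps_const c) k) ((pderiv ^^ k) q))"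
    unfolding fps_diff_op_def by (rule sum.mono_neutral_right) auto
  then show ?thesis by simp
qed

text \<open>Differentiation is linear and iterates additively, so both sides are sums of the terms
  \<open>?h i j\<close>: the Cauchy product ranges over a triangle, the composition over a
  square.\<close>

lemma fps_diff_op_mult: "fps_diff_op (f * g) q = fps_diff_op f (fps_diff_op g q)"
proof -
  let ?n = "degree q"
  let ?h = "\<lambda>i j. smult (fps_nth f i * fps_nth g j) ((pderiv ^^ (i + j)) q)"
  have smult_sum_right: "smult c (sum h A) = (\<Sum>j\<in>A. smult c (h j))"
    for c and h :: "nat \<Rightarrow> 'a poly" and A
    by (rule sum_comp_morphism[symmetric, unfolded o_def]) (simp_all add: smult_add_right)
  have pderiv_le: "degree ((pderiv ^^ k) q) \<le> ?n" for k
    by (simp add: degree_higher_pderiv)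
  have deg: "degree (fps_diff_op g q) \<le> ?n"
    unfolding fps_diff_op_def
    by (intro degree_sum_le) (auto simp: pderiv_le)
  have "fps_diff_op (f * g) q = (\<Sum>k\<le>?n. \<Sum>i\<le>k. ?h i (k - i))"
    by (simp add: fps_diff_op_def fps_mult_nth smult_sum atLeast0AtMost)
  also have "\<dots> = (\<Sum>(i, j)\<in>{(i, j). i + j \<le> ?n}. ?h i j)"
    by (simp add: sum.triangle_reindex_eq)
  \<comment> \<open>Outside the triangle the order \<open>i + j\<close> exceeds the degree of
    \<open>q\<close>, so the added terms are 0.\<close>
  also have "\<dots> = (\<Sum>(i, j)\<in>{..?n} \<times> {..?n}. ?h i j)"
    by (rule sum.mono_neutral_left) (auto simp flip: not_less dest: higher_pderiv_eq_0)
  also have "\<dots> = (\<Sum>i\<le>?n. \<Sum>j\<le>?n. ?h i j)"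
    by (simp add: sum.cartesian_product)
  also have "\<dots> = (\<Sum>i\<le>?n. smult (fps_nth f i) ((pderiv ^^ i) (fps_diff_op g q)))"
    by (simp add: fps_diff_op_def higher_pderiv_sum higher_pderiv_smult smult_sum_right funpow_add)
  also have "\<dots> = fps_diff_op f (fps_diff_op g q)"
    by (rule fps_diff_op_eq_sum[OF deg, symmetric])
  finally show ?thesis .
qed

text \<open>Here \<open>pCons a q\<close> is a + x q. Leibniz' rule has only two terms because the
  second derivative of x vanishes, and an order of at least 1 removes the constant a.\<close>

lemma higher_pderiv_pCons:
  fixes q :: "'a::field_char_0 poly"
  shows "(pderiv ^^ Suc k) (pCons a q)
    = pCons 0 ((pderiv ^^ Suc k) q) + smult (of_nat (Suc k)) ((pderiv ^^ k) q)"
proof (induction k)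
  case (Suc k)
  have "(pderiv ^^ Suc (Suc k)) (pCons a q) = pderiv ((pderiv ^^ Suc k) (pCons a q))"
    by simp
  also have "\<dots> = pCons 0 ((pderiv ^^ Suc (Suc k)) q)
      + smult (of_nat (Suc (Suc k))) ((pderiv ^^ Suc k) q)"
    unfolding Suc.IH by (simp add: pderiv_add pderiv_pCons pderiv_smult smult_add_left numeral_poly)
  finally show ?case .
qed (simp add: pderiv_pCons)

text \<open>This is the commutation rule f(t) x = x f(t) + f'(t) between multiplication by x and
  operators in t. It makes induction over \<open>pCons\<close> possible.\<close>

lemma fps_diff_op_pCons:
  "fps_diff_op f (pCons a q)
    = [:fps_nth f 0 * a:] + pCons 0 (fps_diff_op f q) + fps_diff_op (fps_deriv f) q"
proof -
  let ?n = "degree q"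
  let ?D = "\<lambda>k. (pderiv ^^ k) q"
  have pCons_sum: "pCons 0 (sum h A) = (\<Sum>k\<in>A. pCons 0 (h k))" for h :: "nat \<Rightarrow> 'a poly" and A
    by (rule sum_comp_morphism[symmetric, unfolded o_def]) simp_all
  have "fps_diff_op f (pCons a q)
      = (\<Sum>k\<le>Suc ?n. smult (fps_nth f k) ((pderiv ^^ k) (pCons a q)))"
    by (rule fps_diff_op_eq_sum) (rule degree_pCons_le)
  also have "\<dots> = smult (fps_nth f 0) (pCons a q)
      + (\<Sum>k\<le>?n. smult (fps_nth f (Suc k)) ((pderiv ^^ Suc k) (pCons a q)))"
    by (simp only: sum.atMost_Suc_shift funpow_0)
  also have "(\<Sum>k\<le>?n. smult (fps_nth f (Suc k)) ((pderiv ^^ Suc k) (pCons a q)))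
      = (\<Sum>k\<le>?n. pCons 0 (smult (fps_nth f (Suc k)) (?D (Suc k)))) + fps_diff_op (fps_deriv f) q"
    unfolding higher_pderiv_pCons fps_diff_op_def
    by (simp add: sum.distrib smult_add_right mult.commute del: funpow.simps of_nat_Suc)
  \<comment> \<open>With the bound one above the degree, splitting off the term at 0 leaves exactly
    the shifted sum.\<close>
  also have "(\<Sum>k\<le>?n. pCons 0 (smult (fps_nth f (Suc k)) (?D (Suc k))))
      = pCons 0 (fps_diff_op f q - smult (fps_nth f 0) q)"
    by (subst fps_diff_op_eq_sum[of q "Suc ?n"])
      (simp_all only: sum.atMost_Suc_shift funpow_0 pCons_sum add_diff_cancel_left' le_SucI order.refl)
  finally show ?thesis
    by (simp add: algebra_simps)
qed

text \<open>Taylor's formula. The derivative of \<open>fps_exp c\<close> is c times itself, so the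
  commutation rule turns each factor x into x + c.\<close>

lemma fps_diff_op_exp: "fps_diff_op (fps_exp c) q = pcompose q [:c, 1:]"
proof (induction q)
  case 0
  then show ?case by (simp add: fps_diff_op_def)
next
  case (pCons a q)
  have deriv: "fps_deriv (fps_exp c) = fps_const c * fps_exp c"
    by simp
  show ?case
    unfolding fps_diff_op_pCons deriv fps_diff_op_mult fps_diff_op_const pCons.IH
    by (simp add: pcompose_pCons)
qed

lemma poly_euler_series_shift:
  fixes q :: "'a::field_char_0 poly"
  defines "r \<equiv> fps_diff_op (2 / (fps_exp 1 + 1)) q"
  shows "poly r (x + 1) + poly r x = 2 * poly q x"
proof -
  let ?E = "2 / (fps_exp 1 + 1) :: 'a fps"
  \<comment> \<open>The constant coefficient is 2, which is nonzero in characteristic 0, so the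
    series is a unit and \<open>?E\<close> is a true quotient.\<close>
  have "fps_exp (1::'a) + 1 dvd 1"
    by simp
  then have E: "(fps_exp 1 + 1) * ?E = fps_const 2"
    by (simp add: mult.commute numeral_fps_const)
  have "smult 2 q = fps_diff_op ((fps_exp 1 + 1) * ?E) q"
    unfolding E by (simp add: fps_diff_op_const)
  also have "\<dots> = fps_diff_op (fps_exp 1) r + fps_diff_op (fps_const 1) r"
    by (simp only: fps_diff_op_mult fps_diff_op_add r_def fps_const_1_eq_1)
  also have "\<dots> = pcompose r [:1, 1:] + r"
    by (simp only: fps_diff_op_exp fps_diff_op_const smult_1_left)
  finally have "poly (smult 2 q) x = poly (pcompose r [:1, 1:] + r) x"
    by simp
  then show ?thesis
    by (simp add: poly_pcompose add.commute)
qed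

lemma alternating_sum_telescope:
  fixes f g :: "'a::field_char_0 \<Rightarrow> 'a"
  assumes "\<And>x. g (x + 1) + g x = 2 * f x"
  shows "2 * (\<Sum>y<n. f (x + of_nat y) * (- 1) ^ y) = g x - (- 1) ^ n * g (x + of_nat n)"
proof (induction n)
  case (Suc n)
  have "2 * (f (x + of_nat n) * (- 1) ^ n)
      = (g (x + of_nat (Suc n)) + g (x + of_nat n)) * (- 1) ^ n"
    using assms[of "x + of_nat n"] by (simp add: ac_simps)
  with Suc.IH show ?case
    by (simp add: algebra_simps)
qed simp

section \<open>Limits with respect to the p-adic absolute value\<close>

context padic_complex_field
begin

lemma cabs_nonneg: "0 \<le> cabs x"
  using dist_cabs[of x 0] by (metis diff_zero zero_le_dist)

text \<open>The sort does not tie the metric to the field operations; \<open>dist_cabs\<close> does.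
  Passing to real limits of \<open>cabs\<close> yields the limit laws for sums and products.\<close>

lemma tendsto_cabs_iff: "(f \<longlongrightarrow> l) F \<longleftrightarrow> ((\<lambda>x. cabs (f x - l)) \<longlongrightarrow> 0) F"
  by (subst tendsto_dist_iff) (simp add: dist_cabs)

lemma cabs_power: "cabs (x ^ n) = cabs x ^ n"
proof (induction n)
  case 0
  then show ?case
    using cabs_of_rat[of 1] by (simp add: rat_padic_abs_def)
qed (simp add: cabs_mult)

lemma cabs_prime: "cabs (of_nat p) = 1 / real p"
proof -
  have p: "prime (int p)" "p \<noteq> 0"
    using prime_p by auto
  have "quotient_of (of_nat p) = (int p, 1)"
    using quotient_of_int[of "int p"] by (simp add: Rat.of_int_def)
  with p have "rat_padic_abs p (of_nat p) = 1 / real p"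
    by (simp add: rat_padic_abs_def power_int_minus divide_inverse)
  then show ?thesis
    using cabs_of_rat[of "of_nat p"] by simp
qed

lemma prime_power_tendsto_0: "(\<lambda>N. of_nat (p ^ N) :: 'a) \<longlonglongrightarrow> 0"
proof -
  have "(\<lambda>N. (1 / real p) ^ N) \<longlonglongrightarrow> 0"
    using prime_gt_1_nat[OF prime_p] by (intro LIMSEQ_power_zero) simp
  then show ?thesis
    by (simp add: tendsto_cabs_iff cabs_power cabs_prime)
qed

lemma tendsto_add_cabs:
  fixes f g :: "'b \<Rightarrow> 'a"
  assumes "(f \<longlongrightarrow> a) F" "(g \<longlongrightarrow> b) F"
  shows "((\<lambda>x. f x + g x) \<longlongrightarrow> a + b) F"
  unfolding tendsto_cabs_iff
proof (rule Lim_null_comparison)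
  have "cabs (f x + g x - (a + b)) \<le> max (cabs (f x - a)) (cabs (g x - b))" for x
    using cabs_add_le[of "f x - a" "g x - b"] by (simp add: add_diff_add)
  then show "\<forall>\<^sub>F x in F. norm (cabs (f x + g x - (a + b))) \<le> max (cabs (f x - a)) (cabs (g x - b))"
    by (simp add: cabs_nonneg)
  show "((\<lambda>x. max (cabs (f x - a)) (cabs (g x - b))) \<longlongrightarrow> 0) F"
    using tendsto_max[OF assms[unfolded tendsto_cabs_iff]] by simp
qed

lemma tendsto_mult_cabs:
  fixes f g :: "'b \<Rightarrow> 'a"
  assumes f: "(f \<longlongrightarrow> a) F" and g: "(g \<longlongrightarrow> b) F"
  shows "((\<lambda>x. f x * g x) \<longlongrightarrow> a * b) F"
proof -
  \<comment> \<open>The identity f g = (f - a)(g - b) + b f + a g - a b reduces the claim to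
    multiplication by constants and a product of two null functions.\<close>
  have left: "((\<lambda>x. c * h x) \<longlongrightarrow> c * l) F" if "(h \<longlongrightarrow> l) F" for c l and h :: "_ \<Rightarrow> 'a"
    using tendsto_mult_right_zero[OF that[unfolded tendsto_cabs_iff], of "cabs c"]
    by (simp add: tendsto_cabs_iff cabs_mult flip: right_diff_distrib)
  have "((\<lambda>x. (f x - a) * (g x - b)) \<longlongrightarrow> 0) F"
    using tendsto_mult[OF f[unfolded tendsto_cabs_iff] g[unfolded tendsto_cabs_iff]]
    by (simp add: tendsto_cabs_iff cabs_mult)
  from tendsto_add_cabs[OF tendsto_add_cabs[OF this left[OF f, of b]] left[OF g, of a]]
  have "((\<lambda>x. (f x - a) * (g x - b) + b * f x + a * g x) \<longlongrightarrow> b * a + a * b) F"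
    by simp
  from tendsto_add_cabs[OF this tendsto_const[of "- (a * b)"]] show ?thesis
    by (simp add: algebra_simps)
qed

lemma tendsto_poly_cabs:
  fixes q :: "'a poly"
  assumes "(f \<longlongrightarrow> a) F"
  shows "((\<lambda>x. poly q (f x)) \<longlongrightarrow> poly q a) F"
  by (induction q) (simp_all add: assms tendsto_add_cabs tendsto_mult_cabs)

section \<open>Fermionic integrals of polynomials\<close>

lemma fermionic_sum_poly_tendsto:
  fixes q :: "'a poly" and x :: 'a
  assumes "odd p"
  shows "fermionic_sum p (\<lambda>y. poly q (x + y))
    \<longlonglongrightarrow> poly (fps_diff_op (2 / (fps_exp 1 + 1)) q) x"
proof -
  let ?r = "fps_diff_op (2 / (fps_exp 1 + 1)) q"
  have sum_eq: "fermionic_sum p (\<lambda>y. poly q (x + y)) N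
      = 1 / 2 * (poly ?r x + poly ?r (x + of_nat (p ^ N)))" for N
  proof -
    \<comment> \<open>Since \<open>p ^ N\<close> is odd, the sign in the telescoped sum is -1 and
      the two boundary values add.\<close>
    have twice: "2 * fermionic_sum p (\<lambda>y. poly q (x + y)) N = poly ?r x + poly ?r (x + of_nat (p ^ N))"
      unfolding fermionic_sum_def
      by (subst alternating_sum_telescope[of "poly ?r", OF poly_euler_series_shift]) (simp add: assms)
    show ?thesis
      unfolding twice[symmetric] by simp
  qed
  have "(\<lambda>N. x + of_nat (p ^ N)) \<longlonglongrightarrow> x"
    using tendsto_add_cabs[OF tendsto_const prime_power_tendsto_0, of x] by simp
  then have "(\<lambda>N. 1 / 2 * (poly ?r x + poly ?r (x + of_nat (p ^ N))))
      \<longlonglongrightarrow> 1 / 2 * (poly ?r x + poly ?r x)"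
    by (intro tendsto_add_cabs tendsto_mult_cabs tendsto_poly_cabs tendsto_const)
  then show ?thesis
    unfolding sum_eq[abs_def] mult_2[symmetric] by simp
qed

lemma fermionic_integrable_poly:
  fixes q :: "'a poly" and x :: 'a
  assumes "odd p"
  shows "fermionic_integrable p cabs (\<lambda>y. poly q (x + y))"
  unfolding fermionic_integrable_def continuous_on_def
proof (intro conjI ballI)
  show "((\<lambda>y. poly q (x + y)) \<longlongrightarrow> poly q (x + z)) (at z within padic_integers cabs)" for z
    by (intro tendsto_poly_cabs tendsto_add_cabs tendsto_const tendsto_ident_at)
  show "convergent (fermionic_sum p (\<lambda>y. poly q (x + y)))"
    by (rule convergentI[OF fermionic_sum_poly_tendsto[OF assms]])
qed

lemma fermionic_integral_poly:
  fixes q :: "'a poly" and x :: 'a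
  assumes "odd p"
  shows "fermionic_integral p (\<lambda>y. poly q (x + y))
    = poly (fps_diff_op (2 / (fps_exp 1 + 1)) q) x"
  unfolding fermionic_integral_def by (rule limI[OF fermionic_sum_poly_tendsto[OF assms]])

lemma fermionic_exp_series_eq:
  assumes "odd p"
  shows "fermionic_exp_series p = (2 / (fps_exp 1 + 1) :: 'a fps)"
proof (rule fps_ext)
  fix k
  let ?E = "2 / (fps_exp 1 + 1) :: 'a fps"
  \<comment> \<open>Only the derivative of order k survives at 0, so evaluation there isolates the
    k-th coefficient of \<open>?E\<close>.\<close>
  have "poly ((pderiv ^^ j) (monom (1::'a) k)) 0 = (if j = k then fact k else 0)" for j
    by (simp add: poly_0_coeff_0 coeff_higher_pderiv pochhammer_fact)
  then have "poly (fps_diff_op ?E (monom 1 k)) 0 = (\<Sum>j\<le>k. if j = k then fps_nth ?E k * fact k else 0)"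
    unfolding fps_diff_op_def poly_sum
    by (intro sum.cong) (simp_all add: degree_monom_eq)
  then show "fps_nth (fermionic_exp_series p) k = fps_nth ?E k"
    using fermionic_integral_poly[OF assms, of "monom 1 k" 0]
    by (simp add: fermionic_exp_series_def poly_monom)
qed

end

theorem theorem2p2:
  fixes p :: nat
    and cabs :: "'a::{field_char_0, complete_space} \<Rightarrow> real"
    and q :: "'a poly"
  assumes "padic_complex_field p cabs"
    and "odd p"
  shows "(\<forall>x. fermionic_integrable p cabs (\<lambda>y. poly q (x + y))) \<and>
         (\<forall>k. fermionic_integrable p cabs (\<lambda>y. y ^ k)) \<and>
         (\<forall>x. fermionic_integral p (\<lambda>y. poly q (x + y)) =
              poly (fps_diff_op (fermionic_exp_series p) q) x) \<and>
         fps_diff_op (fermionic_exp_series p) q =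
           fps_diff_op (2 / (fps_exp 1 + 1)) q"
proof -
  interpret padic_complex_field p cabs
    by (fact assms(1))
  \<comment> \<open>Convergence of the moments makes the coefficients of
    \<open>fermionic_exp_series p\<close> true integrals.\<close>
  have "fermionic_integrable p cabs (\<lambda>y. y ^ k)" for k
    using fermionic_integrable_poly[OF assms(2), of "monom 1 k" 0] by (simp add: poly_monom)
  then show ?thesis
    using assms(2)
    by (simp add: fermionic_integrable_poly fermionic_integral_poly fermionic_exp_series_eq)
qed

end
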